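(* Let $n\ge1$ and $s\in(0,n)$. Let $\mu$ be a Borel probability measure on $[0,1]^n$ which has GCP(n) and is $s$-dimensional AD-regular. Then there is $c>0$ such that for every $c'\in(0,c)$ and every $\gamma\in[0,1]^n$, with $\psi(q)=q^{-1/n-c'}$, \[ \dim_{\mathrm{H}}\big(W(\psi,\gamma)\cap\mathrm{supp}(\mu)\big)\le s-\frac{nc'}{\frac1n+c'+1}. \]
   Context: $\|x\|$ is the distance from $x\in\mathbb{R}^n$ to $\mathbb{Z}^n$; $A(\delta,Q,\gamma)=\{x:\|Qx-\gamma\|\le\delta\}$; $W(\psi,\gamma)=\{x:\|qx-\gamma\|\le\psi(q)\text{ for infinitely many }q\}$. $\mu$ has GCP(n) if there is $\alpha>1/n$ such that for every $\gamma\in[0,1]^n$ there are constants $C_1,C_2,M>0$ with $C_2^{-1}Q\delta^n\le\sum_{q=Q}^{2Q}\mu(A(\delta,q,\gamma))\le C_2Q\delta^n$ for all integers $Q\ge M$ and $C_1Q^{-\alpha}\le\delta<1$. $\mu$ is $s$-dimensional AD-regular if there are $c_0,C_0,R_0>0$ with $c_0R^s\le\mu(B(x,R))\le C_0R^s$ for all $x\in\mathrm{supp}(\mu)$ and $0<R<R_0$. *)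

theory Defs
  imports "HOL-Probability.Probability"
begin

section \<open>Hausdorff measure and dimension\<close>

text \<open>
  The gauge \<open>diam(U)\<^sup>t\<close>, with the usual conventions that the empty set contributes \<open>0\<close> and that
  \<open>0\<^sup>0 = 1\<close> (whereas \<open>0 powr 0 = 0\<close>), so that the measure for \<open>t = 0\<close> is counting measure.
\<close>

definition hausdorff_gauge :: "real \<Rightarrow> 'a::metric_space set \<Rightarrow> ennreal" where
  "hausdorff_gauge t U =
     (if U = {} then 0 else if t = 0 then 1 else ennreal (diameter U powr t))"

text \<open>
  Boundedness of the covering sets is required separately, since \<^const>\<open>diameter\<close> is
  unspecified on unbounded sets.
\<close>

definition hausdorff_premeasure :: "real \<Rightarrow> real \<Rightarrow> 'a::metric_space set \<Rightarrow> ennreal" where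
  "hausdorff_premeasure t \<epsilon> A =
     Inf {\<Sum>i. hausdorff_gauge t (U i) |U :: nat \<Rightarrow> 'a set.
            A \<subseteq> (\<Union>i. U i) \<and> (\<forall>i. bounded (U i) \<and> diameter (U i) \<le> \<epsilon>)}"

definition hausdorff_measure :: "real \<Rightarrow> 'a::metric_space set \<Rightarrow> ennreal" where
  "hausdorff_measure t A = (SUP \<epsilon>\<in>{0<..}. hausdorff_premeasure t \<epsilon> A)"

definition hausdorff_dim :: "'a::metric_space set \<Rightarrow> ereal" where
  "hausdorff_dim A = Inf {ereal t |t. 0 \<le> t \<and> hausdorff_measure t A = 0}"


section \<open>Measures on Euclidean space\<close>

definition measure_support :: "'a::topological_space measure \<Rightarrow> 'a set" where
  "measure_support \<mu> = {x. \<forall>U. open U \<longrightarrow> x \<in> U \<longrightarrow> emeasure \<mu> U > 0}"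

definition AD_regular :: "real \<Rightarrow> 'a::metric_space measure \<Rightarrow> bool" where
  "AD_regular s \<mu> \<longleftrightarrow>
     (\<exists>c0>0. \<exists>C0>0. \<exists>R0>0. \<forall>x\<in>measure_support \<mu>. \<forall>R. 0 < R \<and> R < R0 \<longrightarrow>
        c0 * R powr s \<le> measure \<mu> (ball x R) \<and> measure \<mu> (ball x R) \<le> C0 * R powr s)"


section \<open>Inhomogeneous Diophantine approximation\<close>

definition integer_lattice :: "(real^'n) set" where
  "integer_lattice = {z. \<forall>i. z $ i \<in> \<int>}"

definition dist_int :: "real^'n \<Rightarrow> real" where
  "dist_int x = infdist x integer_lattice"

definition approx_set :: "real \<Rightarrow> nat \<Rightarrow> real^'n \<Rightarrow> (real^'n) set" where
  "approx_set \<delta> Q \<gamma> = {x. dist_int (real Q *\<^sub>R x - \<gamma>) \<le> \<delta>}"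

definition well_approx :: "(nat \<Rightarrow> real) \<Rightarrow> real^'n \<Rightarrow> (real^'n) set" where
  "well_approx \<psi> \<gamma> =
     {x. infinite {q. 1 \<le> q \<and> dist_int (real q *\<^sub>R x - \<gamma>) \<le> \<psi> q}}"

text \<open>The dimension \<open>n\<close> is \<open>CARD('n)\<close>, and \<open>cbox 0 1\<close> is the unit cube \<open>[0,1]\<^sup>n\<close>.\<close>

definition GCP :: "(real^'n) measure \<Rightarrow> bool" where
  "GCP \<mu> \<longleftrightarrow>
     (\<exists>\<alpha> > 1 / real CARD('n). \<forall>\<gamma>\<in>cbox 0 1. \<exists>C1>0. \<exists>C2>0. \<exists>M>0.
        \<forall>(Q::nat) \<delta>. real Q \<ge> M \<and> C1 * real Q powr (-\<alpha>) \<le> \<delta> \<and> \<delta> < 1 \<longrightarrow>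
          inverse C2 * real Q * \<delta> ^ CARD('n) \<le> (\<Sum>q=Q..2*Q. measure \<mu> (approx_set \<delta> q \<gamma>)) \<and>
          (\<Sum>q=Q..2*Q. measure \<mu> (approx_set \<delta> q \<gamma>)) \<le> C2 * real Q * \<delta> ^ CARD('n))"

end

theory Submission
  imports Defs "HOL-Real_Asymp.Real_Asymp"
begin

text \<open>
  Put \<open>D = 1/n + c' + 1\<close>. At level \<open>q\<close> the set \<open>A(\<psi>(q), q, \<gamma>)\<close> is a union of balls of radius
  \<open>\<psi>(q)/q = q\<^bsup>-D\<^esup>\<close> about the points \<open>(p + \<gamma>)/q\<close>. By the lower AD-regularity bound each of them that
  meets the support carries, after a slight enlargement, \<open>\<mu>\<close>-mass at least of order \<open>q\<^bsup>-Ds\<^esup>\<close>, and the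
  enlarged balls are disjoint; so at most a multiple of \<open>q\<^bsup>Ds\<^esup> \<mu>(A(3\<psi>(q), q, \<gamma>))\<close> of them are needed
  to cover the support. The counting property bounds the sum of these masses over a
  dyadic block \<open>Q \<le> q \<le> 2Q\<close> by a multiple of \<open>Q\<^bsup>-nc'\<^esup>\<close> as long as \<open>c' < \<alpha> - 1/n\<close>. Hence the block
  contributes at most a multiple of \<open>Q\<^bsup>D(s-t) - nc'\<^esup>\<close> to the \<open>t\<close>-dimensional covering sum, which
  is summable over \<open>Q = 2\<^sup>k\<close> exactly when \<open>t > s - nc'/D\<close>.
\<close>

section \<open>Limsup sets and dyadic summation\<close>

text \<open>Hausdorff-Cantelli: a point lying in infinitely many layers lies in every tail of the
  layers, so each tail covers \<open>A\<close>, and the tails of a convergent series tend to 0. With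
  \<open>t > 0\<close> the gauge is the genuine power of the diameter.\<close>

lemma hausdorff_measure_limsup_eq_0:
  fixes F :: "nat \<Rightarrow> 'a::metric_space set set"
  assumes t: "t > 0"
    and fin: "\<And>q. finite (F q)"
    and bdd: "\<And>q U. U \<in> F q \<Longrightarrow> bounded U"
    and diam: "\<And>q U. U \<in> F q \<Longrightarrow> diameter U \<le> d q"
    and d0: "\<And>q. d q \<ge> 0" and dlim: "d \<longlonglongrightarrow> 0"
    and summ: "summable (\<lambda>q. real (card (F q)) * d q powr t)"
    and A: "\<And>x. x \<in> A \<Longrightarrow> infinite {q. x \<in> \<Union>(F q)}"
  shows "hausdorff_measure t A = 0"
proof -
  \<comment> \<open>The form \<open>0 + ennreal \<eta>\<close> fits
    \<open>ennreal_le_epsilon\<close>, which later removes \<open>\<eta>\<close>.\<close>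
  have "hausdorff_premeasure t \<epsilon> A \<le> 0 + ennreal \<eta>" if \<epsilon>: "\<epsilon> > 0" and \<eta>: "\<eta> > 0" for \<epsilon> \<eta>
  proof -
    obtain N1 where N1: "\<And>m. m \<ge> N1 \<Longrightarrow> norm (\<Sum>i. real (card (F (i+m))) * d (i+m) powr t) < \<eta>"
      using suminf_exist_split[OF \<eta> summ] by blast
    obtain N2 where N2: "\<And>m. m \<ge> N2 \<Longrightarrow> d m < \<epsilon>"
      using order_tendstoD(2)[OF dlim \<epsilon>] by (auto simp: eventually_sequentially)
    \<comment> \<open>Past \<open>N1\<close> the tail sum is below \<open>\<eta>\<close>; past
      \<open>N2\<close> the diameters are admissible for \<open>\<epsilon>\<close>.\<close>
    define N where "N = max N1 N2"
    have "\<forall>q. \<exists>h. bij_betw h {0..<card (F q)} (F q)"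
      using ex_bij_betw_nat_finite[OF fin] by blast
    then obtain g where g: "\<And>q. bij_betw (g q) {0..<card (F q)} (F q)" by metis
    \<comment> \<open>Each finite layer is padded with empty sets, of gauge 0, to a full row indexed
      by the naturals, so that the pairing function can turn the double array into one
      sequence.\<close>
    define V where "V = (\<lambda>(q,i). if i < card (F (q+N)) then g (q+N) i else {})"
    have Vin: "V (q,i) \<in> F (q+N)" if "i < card (F (q+N))" for q i
      using that g[of "q+N"] by (auto simp: V_def bij_betw_def)
    define U where "U = (\<lambda>k. V (prod_decode k))"
    have cover: "A \<subseteq> (\<Union>k. U k)"
    proof
      fix x assume "x \<in> A"
      then obtain q where q: "q \<ge> N" "x \<in> \<Union>(F q)"
        using A[of x] unfolding infinite_nat_iff_unbounded_le by blast
      then obtain X where X: "X \<in> F q" "x \<in> X" by blast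
      then have "X \<in> g q ` {0..<card (F q)}"
        using g[of q] by (simp add: bij_betw_def)
      then obtain i where i: "i < card (F q)" "x \<in> g q i"
        using X by auto
      then have "x \<in> U (prod_encode (q - N, i))"
        using q by (simp add: U_def V_def)
      then show "x \<in> (\<Union>k. U k)" by blast
    qed
    have small: "bounded (V p) \<and> diameter (V p) \<le> \<epsilon>" for p
    proof (cases p)
      case (Pair q i)
      show ?thesis
      proof (cases "i < card (F (q+N))")
        case True
        with bdd[OF Vin] diam[OF Vin] N2[of "q+N"] Pair show ?thesis
          by (force simp: N_def)
      next
        case False
        then show ?thesis using \<epsilon> Pair by (simp add: V_def)
      qed
    qed
    have gauge: "hausdorff_gauge t (V (q,i)) \<le> ennreal (d (q+N) powr t)"
      if "i < card (F (q+N))" for q i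
      using diam[OF Vin[OF that]] bdd[OF Vin[OF that]] t
      by (auto simp: hausdorff_gauge_def intro!: ennreal_leI powr_mono2 diameter_ge_0)
    have inner: "(\<Sum>i. hausdorff_gauge t (V (q,i))) \<le> ennreal (real (card (F (q+N))) * d (q+N) powr t)"
      for q
    proof -
      have "(\<Sum>i. hausdorff_gauge t (V (q,i))) = (\<Sum>i<card (F (q+N)). hausdorff_gauge t (V (q,i)))"
        by (rule suminf_finite) (auto simp: V_def hausdorff_gauge_def)
      also have "\<dots> \<le> (\<Sum>i<card (F (q+N)). ennreal (d (q+N) powr t))"
        by (intro sum_mono gauge) simp
      also have "\<dots> = ennreal (real (card (F (q+N))) * d (q+N) powr t)"
        by (simp add: ennreal_mult ennreal_of_nat_eq_real_of_nat)
      finally show ?thesis .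
    qed
    have "(\<Sum>k. hausdorff_gauge t (U k)) = (\<Sum>q. \<Sum>i. hausdorff_gauge t (V (q,i)))"
      unfolding U_def
      using suminf_ennreal_2dimen[of "\<lambda>q. \<Sum>i. hausdorff_gauge t (V (q,i))"
          "\<lambda>p. hausdorff_gauge t (V p)"]
      by (simp add: comp_def)
    also have "\<dots> \<le> (\<Sum>q. ennreal (real (card (F (q+N))) * d (q+N) powr t))"
      by (intro suminf_le inner) auto
    also have "\<dots> = ennreal (\<Sum>q. real (card (F (q+N))) * d (q+N) powr t)"
      using summable_ignore_initial_segment[OF summ, of N] by (intro suminf_ennreal2) auto
    also have "\<dots> \<le> ennreal \<eta>"
      using N1[of N] by (intro ennreal_leI) (auto simp: N_def)
    finally have "(\<Sum>k. hausdorff_gauge t (U k)) \<le> ennreal \<eta>" .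
    moreover have "hausdorff_premeasure t \<epsilon> A \<le> (\<Sum>k. hausdorff_gauge t (U k))"
      unfolding hausdorff_premeasure_def
      using cover small by (intro Inf_lower CollectI exI[of _ U]) (simp add: U_def)
    ultimately show ?thesis by simp
  qed
  then have "hausdorff_premeasure t \<epsilon> A \<le> 0" if "\<epsilon> > 0" for \<epsilon>
    using that by (metis ennreal_le_epsilon)
  then have "hausdorff_measure t A \<le> 0"
    unfolding hausdorff_measure_def by (intro SUP_least) simp
  then show ?thesis by simp
qed

text \<open>The half-open blocks from \<open>2^j*K\<close> to \<open>2^(j+1)*K\<close> tile
  everything beyond \<open>K\<close>, and each is contained in a closed block of the hypothesis.
  Their sums are dominated by a geometric series of ratio \<open>2 powr (-\<beta>)\<close>.\<close>

lemma summable_dyadic_blocks: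
  fixes a :: "nat \<Rightarrow> real"
  assumes a0: "\<And>q. a q \<ge> 0" and \<beta>: "\<beta> > 0" and K: "K \<ge> 1" and C: "C \<ge> 0"
    and blk: "\<And>Q. Q \<ge> K \<Longrightarrow> (\<Sum>q=Q..2*Q. a q) \<le> C * real Q powr (-\<beta>)"
  shows "summable a"
proof -
  define r :: real where "r = 2 powr (-\<beta>)"
  have r: "0 < r" "r < 1" using \<beta> by (auto simp: r_def powr_less_one)
  define B where "B = C * real K powr (-\<beta>)"
  have B0: "B \<ge> 0" using C by (simp add: B_def)
  have step: "(\<Sum>q=K..<2^j*K. a q) \<le> (\<Sum>i<j. B * r ^ i)" for j
  proof (induction j)
    case (Suc j)
    define Q where "Q = 2^j*K"
    have Q: "Q \<ge> K" by (simp add: Q_def)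
    have "(\<Sum>q=K..<2^Suc j*K. a q) = (\<Sum>q=K..<Q. a q) + (\<Sum>q=Q..<2*Q. a q)"
      using Q by (subst sum.atLeastLessThan_concat) (auto simp: Q_def mult.assoc)
    also have "(\<Sum>q=Q..<2*Q. a q) \<le> (\<Sum>q=Q..2*Q. a q)"
      by (intro sum_mono2) (auto simp: a0)
    also have "\<dots> \<le> C * real Q powr (-\<beta>)" using blk[OF Q] .
    also have "\<dots> = B * r ^ j"
      by (simp add: Q_def B_def r_def powr_mult powr_power mult.commute
          flip: powr_realpow powr_powr)
         (simp add: powr_powr mult.commute)
    finally show ?case using Suc by (simp add: Q_def)
  qed simp
  have "(\<Sum>q<m. a q) \<le> (\<Sum>q<K. a q) + B * (1 / (1 - r))" for m
  proof -
    \<comment> \<open>A crude bound is enough: \<open>m\<close> full blocks reach past the index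
      \<open>m\<close>.\<close>
    have m: "m \<le> 2^m * K"
      using K less_exp[of m] mult_le_mono[of m "2^m" 1 K] by simp
    have "(\<Sum>q<m. a q) \<le> (\<Sum>q<2^m*K. a q)"
      using m by (intro sum_mono2) (auto simp: a0)
    also have "\<dots> = (\<Sum>q<K. a q) + (\<Sum>q=K..<2^m*K. a q)"
      unfolding lessThan_atLeast0 by (subst sum.atLeastLessThan_concat) auto
    also have "\<dots> \<le> (\<Sum>q<K. a q) + B * (\<Sum>i<m. r ^ i)"
      using step[of m] by (simp add: sum_distrib_left)
    also have "(\<Sum>i<m. r ^ i) \<le> 1 / (1 - r)"
      using r by (simp add: sum_gp_strict divide_right_mono)
    finally show ?thesis using B0 by (simp add: mult_left_mono)
  qed
  then show ?thesis
    by (intro summableI_nonneg_bounded[OF a0])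
qed

section \<open>Distance to the integer lattice\<close>

lemma integer_lattice_separated:
  assumes "z \<in> integer_lattice" "w \<in> integer_lattice" "z \<noteq> w"
  shows "norm (z - w) \<ge> 1"
proof -
  obtain i where i: "z $ i \<noteq> w $ i" using assms(3) by (auto simp: vec_eq_iff)
  have "z $ i - w $ i \<in> \<int>" using assms by (auto simp: integer_lattice_def)
  then have "1 \<le> \<bar>z $ i - w $ i\<bar>" using i by (intro Ints_nonzero_abs_ge1) auto
  also have "\<dots> \<le> norm (z - w)" using component_le_norm_cart[of "z - w" i] by simp
  finally show ?thesis .
qed

lemma zero_in_integer_lattice: "0 \<in> integer_lattice"
  by (simp add: integer_lattice_def)

lemma dist_int_le: "z \<in> integer_lattice \<Longrightarrow> dist_int x \<le> norm (x - z)"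
  unfolding dist_int_def by (simp add: infdist_le flip: dist_norm)

text \<open>A strict bound on an infimum yields a witness at once, without showing that the nearest
  lattice point is attained.\<close>

lemma dist_int_lessE:
  fixes x :: "real^'n"
  assumes "dist_int x < \<delta>"
  obtains z where "z \<in> integer_lattice" "norm (x - z) < \<delta>"
proof -
  have ne: "(integer_lattice :: (real^'n) set) \<noteq> {}" using zero_in_integer_lattice by blast
  then have "(INF z\<in>integer_lattice. dist x z) < \<delta>"
    using assms by (simp add: dist_int_def infdist_notempty)
  then obtain z where "z \<in> integer_lattice" "dist x z < \<delta>"
    using cINF_less_iff[OF ne, of "dist x"] by (auto intro: bdd_belowI2[of _ 0])
  then show thesis using that by (simp add: dist_norm)
qed

lemma approx_set_borel [measurable]: "approx_set \<delta> q \<gamma> \<in> sets borel"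
  unfolding approx_set_def dist_int_def
  by (intro borel_closed closed_Collect_le continuous_intros)

lemma approx_set_mono: "\<delta> \<le> \<epsilon> \<Longrightarrow> approx_set \<delta> q \<gamma> \<subseteq> approx_set \<epsilon> q \<gamma>"
  by (auto simp: approx_set_def)

section \<open>Covering the support at a single level\<close>

text \<open>A packing argument: every cell that meets the support contains the centre of a ball of
  mass at least \<open>m\<close>. These balls are disjoint and stay inside the set for
  \<open>3*\<delta>\<close>, whose mass therefore bounds their number times
  \<open>m\<close>.\<close>

lemma approx_set_support_cover:
  fixes \<mu> :: "(real^'n) measure"
  assumes "prob_space \<mu>" and sets: "sets \<mu> = sets borel"
    and q: "q \<ge> 1" and \<delta>: "0 < \<delta>" "6 * \<delta> \<le> 1" and m: "0 < m"
    and lower: "\<And>x. x \<in> measure_support \<mu> \<Longrightarrow> m \<le> measure \<mu> (ball x (\<delta> / real q))"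
  shows "\<exists>F. finite F \<and> real (card F) * m \<le> measure \<mu> (approx_set (3*\<delta>) q \<gamma>) \<and>
           (\<forall>U\<in>F. bounded U \<and> diameter U \<le> 4 * \<delta> / real q) \<and>
           approx_set \<delta> q \<gamma> \<inter> measure_support \<mu> \<subseteq> \<Union>F"
proof -
  interpret prob_space \<mu> by fact
  have q0: "real q > 0" using q by simp
  \<comment> \<open>The ball of radius \<open>2*\<delta>/q\<close> about
    \<open>(z + \<gamma>)/q\<close>. Radius \<open>2*\<delta>\<close> instead of
    \<open>\<delta>\<close> provides the strict inequality that \<open>dist_int_lessE\<close> asks
    for.\<close>
  define E where "E = (\<lambda>z. {x. norm (real q *\<^sub>R x - \<gamma> - z) < 2 * \<delta>})"
  define Z where "Z = {z \<in> integer_lattice. \<exists>x\<in>measure_support \<mu>. x \<in> E z}"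
  have "\<forall>z\<in>Z. \<exists>x. x \<in> measure_support \<mu> \<and> x \<in> E z" by (auto simp: Z_def)
  then obtain c where c: "\<And>z. z \<in> Z \<Longrightarrow> c z \<in> measure_support \<mu>" "\<And>z. z \<in> Z \<Longrightarrow> c z \<in> E z"
    by metis
  define B where "B = (\<lambda>z. ball (c z) (\<delta> / real q))"
  have B3: "norm (real q *\<^sub>R y - \<gamma> - z) < 3 * \<delta>" if "z \<in> Z" "y \<in> B z" for y z
  proof -
    have "real q *\<^sub>R y - \<gamma> - z = real q *\<^sub>R (y - c z) + (real q *\<^sub>R c z - \<gamma> - z)"
      by (simp add: algebra_simps)
    then have "norm (real q *\<^sub>R y - \<gamma> - z)
        \<le> norm (real q *\<^sub>R (y - c z)) + norm (real q *\<^sub>R c z - \<gamma> - z)"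
      by (metis norm_triangle_ineq)
    moreover have "norm (real q *\<^sub>R (y - c z)) < \<delta>"
      using that q0 by (simp add: B_def dist_norm norm_minus_commute pos_less_divide_eq mult.commute)
    moreover have "norm (real q *\<^sub>R c z - \<gamma> - z) < 2 * \<delta>"
      using c(2)[OF that(1)] by (simp add: E_def)
    ultimately show ?thesis by linarith
  qed
  have disj: "disjoint_family_on B Z"
    unfolding disjoint_family_on_def
  proof (intro ballI impI, rule ccontr)
    fix z w assume zw: "z \<in> Z" "w \<in> Z" "z \<noteq> w" "B z \<inter> B w \<noteq> {}"
    then obtain y where y: "y \<in> B z" "y \<in> B w" by blast
    \<comment> \<open>A common point \<open>y\<close> would put \<open>z\<close> and
      \<open>w\<close> at distance below \<open>3*\<delta> + 3*\<delta>\<close>; this is where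
      \<open>6 * \<delta> \<le> 1\<close> enters.\<close>
    have "z - w = (real q *\<^sub>R y - \<gamma> - w) - (real q *\<^sub>R y - \<gamma> - z)" by simp
    then have "norm (z - w) \<le> norm (real q *\<^sub>R y - \<gamma> - w) + norm (real q *\<^sub>R y - \<gamma> - z)"
      by (metis norm_triangle_ineq4)
    with B3[OF zw(1) y(1)] B3[OF zw(2) y(2)] \<delta> have "norm (z - w) < 1" by linarith
    with integer_lattice_separated[of z w] zw show False by (auto simp: Z_def)
  qed
  have BA: "B z \<subseteq> approx_set (3*\<delta>) q \<gamma>" if "z \<in> Z" for z
  proof
    fix y assume "y \<in> B z"
    from B3[OF that this] dist_int_le[of z "real q *\<^sub>R y - \<gamma>"] that
    show "y \<in> approx_set (3*\<delta>) q \<gamma>" by (auto simp: approx_set_def Z_def)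
  qed
  have count: "real (card Y) * m \<le> measure \<mu> (approx_set (3*\<delta>) q \<gamma>)" if Y: "Y \<subseteq> Z" "finite Y" for Y
  proof -
    have "real (card Y) * m = (\<Sum>z\<in>Y. m)" by simp
    also have "\<dots> \<le> (\<Sum>z\<in>Y. measure \<mu> (B z))"
      using Y c lower by (intro sum_mono) (auto simp: B_def)
    also have "\<dots> = measure \<mu> (\<Union>z\<in>Y. B z)"
      using Y disjoint_family_on_mono[OF Y(1) disj]
      by (intro finite_measure_finite_Union[symmetric]) (auto simp: sets B_def)
    also have "\<dots> \<le> measure \<mu> (approx_set (3*\<delta>) q \<gamma>)"
      using Y BA by (intro finite_measure_mono) (auto simp: sets)
    finally show ?thesis .
  qed
  \<comment> \<open>Total mass 1 bounds all finite subsets of \<open>Z\<close> uniformly, which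
    forces \<open>Z\<close> itself to be finite.\<close>
  have "card Y \<le> nat \<lfloor>1 / m\<rfloor>" if Y: "Y \<subseteq> Z" "finite Y" for Y
  proof -
    have "real (card Y) * m \<le> 1"
      using count[OF Y] prob_le_1 by (rule order_trans)
    then show ?thesis using m by (simp add: le_nat_floor pos_le_divide_eq)
  qed
  then have finZ: "finite Z" using finite_if_finite_subsets_card_bdd by blast
  have E: "bounded (E z) \<and> diameter (E z) \<le> 4 * \<delta> / real q" for z
  proof -
    have close: "norm (x - y) \<le> 4 * \<delta> / real q" if "x \<in> E z" "y \<in> E z" for x y
    proof -
      have "real q *\<^sub>R (x - y) = (real q *\<^sub>R x - \<gamma> - z) - (real q *\<^sub>R y - \<gamma> - z)"
        by (simp add: algebra_simps)
      then have "norm (real q *\<^sub>R (x - y))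
          \<le> norm (real q *\<^sub>R x - \<gamma> - z) + norm (real q *\<^sub>R y - \<gamma> - z)"
        by (metis norm_triangle_ineq4)
      then have "real q * norm (x - y) \<le> 4 * \<delta>" using that by (simp add: E_def)
      then show ?thesis using q0 by (simp add: pos_le_divide_eq mult.commute)
    qed
    have "bounded (E z)"
      by (rule bounded_two_points[THEN iffD2]) (use close in \<open>auto simp: dist_norm\<close>)
    moreover have "diameter (E z) \<le> 4 * \<delta> / real q"
      using close \<delta> by (intro diameter_le) auto
    ultimately show ?thesis by blast
  qed
  have "real (card (E ` Z)) * m \<le> real (card Z) * m"
    using card_image_le[OF finZ, of E] m by (intro mult_right_mono) auto
  also have "\<dots> \<le> measure \<mu> (approx_set (3*\<delta>) q \<gamma>)" using finZ by (intro count) auto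
  finally have card: "real (card (E ` Z)) * m \<le> measure \<mu> (approx_set (3*\<delta>) q \<gamma>)" .
  have "approx_set \<delta> q \<gamma> \<inter> measure_support \<mu> \<subseteq> \<Union>(E ` Z)"
  proof
    fix x assume x: "x \<in> approx_set \<delta> q \<gamma> \<inter> measure_support \<mu>"
    then have "dist_int (real q *\<^sub>R x - \<gamma>) < 2 * \<delta>" using \<delta> by (auto simp: approx_set_def)
    then obtain z where "z \<in> integer_lattice" "norm (real q *\<^sub>R x - \<gamma> - z) < 2 * \<delta>"
      by (rule dist_int_lessE)
    then show "x \<in> \<Union>(E ` Z)" using x by (auto simp: Z_def E_def)
  qed
  with card E finZ show ?thesis by (intro exI[of _ "E ` Z"]) auto
qed

section \<open>Convergence of the covering sums\<close>

text \<open>Solved for \<open>t\<close>, the hypothesis \<open>exponent\<close> reads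
  \<open>t > s - (\<tau>*n - 1)/(\<tau> + 1)\<close>, which for \<open>\<tau> = 1/n + c'\<close> is
  the threshold of the theorem. Here \<open>n\<close> is any natural number, later set to the
  dimension.\<close>

lemma hausdorff_measure_well_approx_eq_0:
  fixes \<mu> :: "(real^'n) measure"
  assumes "prob_space \<mu>" and sets: "sets \<mu> = sets borel"
    and \<tau>: "\<tau> > 0" and c0: "c0 > 0" and R0: "R0 > 0"
    and lower: "\<And>x R. x \<in> measure_support \<mu> \<Longrightarrow> 0 < R \<Longrightarrow> R < R0 \<Longrightarrow>
                  c0 * R powr s \<le> measure \<mu> (ball x R)"
    and C1: "C1 > 0" and C2: "C2 > 0" and \<alpha>: "\<alpha> > \<tau>"
    and count: "\<And>(Q::nat) \<delta>. real Q \<ge> M \<Longrightarrow> C1 * real Q powr (-\<alpha>) \<le> \<delta> \<Longrightarrow> \<delta> < 1 \<Longrightarrow>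
                  (\<Sum>q=Q..2*Q. measure \<mu> (approx_set \<delta> q \<gamma>)) \<le> C2 * real Q * \<delta> ^ n"
    and t: "0 < t" "t \<le> s" and exponent: "1 + (\<tau> + 1) * (s - t) < \<tau> * real n"
  shows "hausdorff_measure t (well_approx (\<lambda>q. real q powr (-\<tau>)) \<gamma> \<inter> measure_support \<mu>) = 0"
proof -
  let ?r = "\<lambda>q::nat. real q powr (-\<tau> - 1)"
  let ?\<psi> = "\<lambda>q::nat. real q powr (-\<tau>)"
  \<comment> \<open>In turn: the radius is in the range of AD-regularity, the balls are disjoint and
    \<open>3 * ?\<psi> q < 1\<close>, and, thanks to \<open>\<alpha> > \<tau>\<close>, the value
    \<open>3 * ?\<psi> q\<close> is large enough for \<open>count\<close>.\<close>
  have "\<forall>\<^sub>F q in sequentially. ?r q < R0"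
    using \<tau> R0 by real_asymp
  moreover have "\<forall>\<^sub>F q in sequentially. 6 * ?\<psi> q < 1"
    using \<tau> by real_asymp
  moreover have "\<forall>\<^sub>F q in sequentially. C1 * real q powr (-\<alpha>) < 3 * ?\<psi> q"
    using \<tau> \<alpha> C1 by real_asymp
  moreover have "\<forall>\<^sub>F q in sequentially. M \<le> real q"
    by real_asymp
  moreover have "\<forall>\<^sub>F q in sequentially. 1 \<le> q"
    by (rule eventually_ge_at_top)
  ultimately have "\<forall>\<^sub>F q in sequentially. ?r q < R0 \<and> 6 * ?\<psi> q < 1 \<and>
      C1 * real q powr (-\<alpha>) < 3 * ?\<psi> q \<and> M \<le> real q \<and> 1 \<le> q"
    by eventually_elim auto
  then obtain K where K: "\<And>q. q \<ge> K \<Longrightarrow> ?r q < R0 \<and> 6 * ?\<psi> q < 1 \<and>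
      C1 * real q powr (-\<alpha>) < 3 * ?\<psi> q \<and> M \<le> real q \<and> 1 \<le> q"
    by (auto simp: eventually_sequentially)
  have K1: "K \<ge> 1" using K[of K] by simp
  have r_eq: "?\<psi> q / real q = ?r q" if "q \<ge> 1" for q
    using that by (simp add: powr_diff)
  have "\<exists>F. finite F \<and> real (card F) * (c0 * ?r q powr s) \<le> measure \<mu> (approx_set (3 * ?\<psi> q) q \<gamma>) \<and>
           (\<forall>U\<in>F. bounded U \<and> diameter U \<le> 4 * ?r q) \<and>
           approx_set (?\<psi> q) q \<gamma> \<inter> measure_support \<mu> \<subseteq> \<Union>F" if "q \<ge> K" for q
  proof -
    have q: "q \<ge> 1" "?r q < R0" "6 * ?\<psi> q < 1" using K[OF that] by auto
    then have "?r q > 0" by simp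
    with approx_set_support_cover[OF assms(1) sets q(1), where \<delta> = "?\<psi> q"
        and m = "c0 * ?r q powr s" and \<gamma> = \<gamma>] lower q c0
    show ?thesis by (simp add: r_eq flip: times_divide_eq_right)
  qed
  then obtain F0 where F0: "\<And>q. q \<ge> K \<Longrightarrow> finite (F0 q)"
    "\<And>q. q \<ge> K \<Longrightarrow> real (card (F0 q)) * (c0 * ?r q powr s) \<le> measure \<mu> (approx_set (3 * ?\<psi> q) q \<gamma>)"
    "\<And>q U. q \<ge> K \<Longrightarrow> U \<in> F0 q \<Longrightarrow> bounded U \<and> diameter U \<le> 4 * ?r q"
    "\<And>q. q \<ge> K \<Longrightarrow> approx_set (?\<psi> q) q \<gamma> \<inter> measure_support \<mu> \<subseteq> \<Union>(F0 q)"
    by metis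
  \<comment> \<open>Emptying the layers below \<open>K\<close> discards only finitely many
    \<open>q\<close>, which a limsup set does not notice.\<close>
  define F where "F = (\<lambda>q. if q \<ge> K then F0 q else {})"
  let ?a = "\<lambda>q. real (card (F q)) * (4 * ?r q) powr t"
  \<comment> \<open>The price of passing from \<open>t\<close> to \<open>s\<close>:
    \<open>r^t = q^e * r^s\<close> for \<open>r = ?r q\<close>.\<close>
  define e where "e = (\<tau> + 1) * (s - t)"
  have e0: "e \<ge> 0" using t \<tau> by (simp add: e_def)
  \<comment> \<open>The factor \<open>4 powr t / c0\<close> comes from the diameters and the lower
    mass bound, \<open>2 powr e\<close> from \<open>q \<le> 2*Q\<close>, and
    \<open>C2 * 3 ^ n\<close> from \<open>count\<close> at \<open>3 * ?\<psi> Q\<close>.\<close>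
  define C where "C = 4 powr t / c0 * 2 powr e * C2 * 3 ^ n"
  have term_le: "?a q \<le> 4 powr t / c0 * real q powr e * measure \<mu> (approx_set (3 * ?\<psi> q) q \<gamma>)"
    if "q \<ge> K" for q
  proof -
    have "(-\<tau> - 1) * t = e + (-\<tau> - 1) * s" by (simp add: e_def algebra_simps)
    then have "?r q powr t = real q powr e * ?r q powr s"
      by (simp only: powr_powr powr_add)
    then have "?a q = 4 powr t / c0 * real q powr e * (real (card (F0 q)) * (c0 * ?r q powr s))"
      using that c0 by (simp add: F_def powr_mult)
    also have "\<dots> \<le> 4 powr t / c0 * real q powr e * measure \<mu> (approx_set (3 * ?\<psi> q) q \<gamma>)"
      using F0(2)[OF that] c0 by (intro mult_left_mono) auto
    finally show ?thesis .
  qed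
  interpret prob_space \<mu> by fact
  have "summable ?a"
  \<comment> \<open>The decay rate is the slack in \<open>exponent\<close>: a block contributes the
    powers \<open>e\<close>, \<open>1\<close> and \<open>-\<tau>*n\<close> of
    \<open>Q\<close>.\<close>
  proof (rule summable_dyadic_blocks[where \<beta> = "\<tau> * real n - 1 - e" and C = C])
    show "0 < \<tau> * real n - 1 - e" using exponent by (simp add: e_def)
    show "0 \<le> C" using C2 c0 by (simp add: C_def)
    fix Q assume Q: "Q \<ge> K"
    have Q0: "real Q > 0" using K[OF Q] by simp
    \<comment> \<open>The growing factor is frozen at \<open>2*Q\<close> and the decreasing
      \<open>?\<psi>\<close> at \<open>Q\<close>, since \<open>count\<close> needs one
      \<open>\<delta>\<close> for the whole block.\<close>
    have "(\<Sum>q=Q..2*Q. ?a q) \<le>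
        (\<Sum>q=Q..2*Q. 4 powr t / c0 * real (2*Q) powr e * measure \<mu> (approx_set (3 * ?\<psi> Q) q \<gamma>))"
    proof (rule sum_mono)
      fix q assume q: "q \<in> {Q..2*Q}"
      have "?\<psi> q \<le> ?\<psi> Q" using q Q0 \<tau> by (intro powr_mono2') auto
      then have "measure \<mu> (approx_set (3 * ?\<psi> q) q \<gamma>) \<le> measure \<mu> (approx_set (3 * ?\<psi> Q) q \<gamma>)"
        by (intro finite_measure_mono approx_set_mono) (auto simp: sets)
      moreover have "real q powr e \<le> real (2*Q) powr e"
        using q e0 by (intro powr_mono2) auto
      ultimately have "4 powr t / c0 * real q powr e * measure \<mu> (approx_set (3 * ?\<psi> q) q \<gamma>)
          \<le> 4 powr t / c0 * real (2*Q) powr e * measure \<mu> (approx_set (3 * ?\<psi> Q) q \<gamma>)"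
        using c0 by (intro mult_mono) auto
      with term_le[of q] q Q
      show "?a q \<le> 4 powr t / c0 * real (2*Q) powr e * measure \<mu> (approx_set (3 * ?\<psi> Q) q \<gamma>)"
        by simp
    qed
    also have "\<dots> = 4 powr t / c0 * real (2*Q) powr e * (\<Sum>q=Q..2*Q. measure \<mu> (approx_set (3 * ?\<psi> Q) q \<gamma>))"
      by (simp add: sum_distrib_left)
    also have "\<dots> \<le> 4 powr t / c0 * real (2*Q) powr e * (C2 * real Q * (3 * ?\<psi> Q) ^ n)"
      using K[OF Q] c0 by (intro mult_left_mono count) auto
    also have "\<dots> = C * (real Q powr e * real Q powr 1 * real Q powr (-\<tau> * real n))"
      using Q0 by (simp add: C_def powr_mult power_mult_distrib powr_power mult.commute[of \<tau>])
    also have "\<dots> = C * real Q powr (- (\<tau> * real n - 1 - e))"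
    proof -
      have "- (\<tau> * real n - 1 - e) = e + 1 + (-\<tau> * real n)" by simp
      then show ?thesis by (simp only: powr_add)
    qed
    finally show "(\<Sum>q=Q..2*Q. ?a q) \<le> C * real Q powr (- (\<tau> * real n - 1 - e))" .
  qed (use K1 in auto)
  moreover have "(\<lambda>q. 4 * ?r q) \<longlonglongrightarrow> 0" using \<tau> by real_asymp
  moreover have "infinite {q. x \<in> \<Union>(F q)}"
    if x: "x \<in> well_approx ?\<psi> \<gamma> \<inter> measure_support \<mu>" for x
  proof
    assume fin: "finite {q. x \<in> \<Union>(F q)}"
    have "{q. 1 \<le> q \<and> dist_int (real q *\<^sub>R x - \<gamma>) \<le> ?\<psi> q} \<subseteq> {q. x \<in> \<Union>(F q)} \<union> {..<K}"
    proof
      fix q assume "q \<in> {q. 1 \<le> q \<and> dist_int (real q *\<^sub>R x - \<gamma>) \<le> ?\<psi> q}"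
      then have "x \<in> approx_set (?\<psi> q) q \<gamma> \<inter> measure_support \<mu>"
        using x by (simp add: approx_set_def)
      then have "x \<in> \<Union>(F0 q)" if "q \<ge> K" using F0(4)[OF that] by blast
      then show "q \<in> {q. x \<in> \<Union>(F q)} \<union> {..<K}" by (cases "q \<ge> K") (auto simp: F_def)
    qed
    then have "finite {q. 1 \<le> q \<and> dist_int (real q *\<^sub>R x - \<gamma>) \<le> ?\<psi> q}"
      by (rule finite_subset) (use fin in simp)
    with x show False by (simp add: well_approx_def)
  qed
  ultimately show ?thesis
    using t F0
    by (intro hausdorff_measure_limsup_eq_0[where F = F and d = "\<lambda>q. 4 * ?r q"])
       (auto simp: F_def split: if_splits)
qed

section \<open>From null measure to dimension\<close>

text \<open>The dimension is an infimum, so exponents just above \<open>a\<close> decide. The cap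
  \<open>b\<close> allows restricting to \<open>t < s\<close> later, and \<open>0 \<le> a\<close>
  keeps these exponents admissible.\<close>

lemma hausdorff_dim_le:
  assumes "\<And>t. a < t \<Longrightarrow> t < b \<Longrightarrow> hausdorff_measure t A = 0" and "0 \<le> a" "a < b"
  shows "hausdorff_dim A \<le> ereal a"
proof (rule dense_ge_bounded[of "ereal a" "ereal b"])
  fix u assume u: "ereal a < u" "u < ereal b"
  then obtain t where "u = ereal t" by (cases u) auto
  with u assms show "hausdorff_dim A \<le> u"
    unfolding hausdorff_dim_def by (intro Inf_lower) auto
qed (use assms in simp)

theorem theorem9p2:
  fixes \<mu> :: "(real^'n) measure" and s :: real
  assumes "0 < s" and "s < real CARD('n)"
    and "sets \<mu> = sets borel" and "prob_space \<mu>" and "emeasure \<mu> (cbox 0 1) = 1"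
    and "GCP \<mu>" and "AD_regular s \<mu>"
  shows "\<exists>c>0. \<forall>c'. 0 < c' \<and> c' < c \<longrightarrow> (\<forall>\<gamma>\<in>cbox 0 1.
           hausdorff_dim (well_approx (\<lambda>q. real q powr (- 1 / real CARD('n) - c')) \<gamma>
                          \<inter> measure_support \<mu>)
             \<le> ereal (s - real CARD('n) * c' / (1 / real CARD('n) + c' + 1)))"
proof -
  define n where "n = CARD('n)"
  have n: "real n > 0" by (simp add: n_def)
  obtain \<alpha> where \<alpha>: "\<alpha> > 1 / real n"
    and gcp: "\<And>\<gamma>. \<gamma> \<in> cbox (0::real^'n) 1 \<Longrightarrow> \<exists>C1>0. \<exists>C2>0. \<exists>M>0.
        \<forall>(Q::nat) \<delta>. real Q \<ge> M \<and> C1 * real Q powr (-\<alpha>) \<le> \<delta> \<and> \<delta> < 1 \<longrightarrow>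
          (\<Sum>q=Q..2*Q. measure \<mu> (approx_set \<delta> q \<gamma>)) \<le> C2 * real Q * \<delta> ^ n"
    using \<open>GCP \<mu>\<close> unfolding GCP_def n_def by meson
  obtain c0 R0 where c0: "c0 > 0" "R0 > 0"
    and lower: "\<And>x R. x \<in> measure_support \<mu> \<Longrightarrow> 0 < R \<Longrightarrow> R < R0 \<Longrightarrow>
                  c0 * R powr s \<le> measure \<mu> (ball x R)"
    using \<open>AD_regular s \<mu>\<close> unfolding AD_regular_def by meson
  \<comment> \<open>The first bound gives \<open>\<tau> < \<alpha>\<close>, so that the counting
    property reaches the scale of \<open>\<psi>\<close>. The second gives \<open>n*c' < s\<close>,
    so that the claimed dimension bound is nonnegative.\<close>
  define c where "c = min (\<alpha> - 1 / real n) (s / real n)"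
  have "hausdorff_dim (well_approx (\<lambda>q. real q powr (- 1 / real n - c')) \<gamma> \<inter> measure_support \<mu>)
           \<le> ereal (s - real n * c' / (1 / real n + c' + 1))"
    if c': "0 < c'" "c' < c" and \<gamma>: "\<gamma> \<in> cbox 0 1" for c' \<gamma>
  proof (rule hausdorff_dim_le)
    define \<tau> where "\<tau> = 1 / real n + c'"
    have \<tau>: "\<tau> > 0" "\<tau> < \<alpha>" using c' n by (auto simp: \<tau>_def c_def add_pos_pos)
    \<comment> \<open>The 1 cancels the length of a dyadic block; \<open>n*c'\<close> is the decay
      that remains.\<close>
    have \<tau>n: "\<tau> * real n = 1 + real n * c'" using n by (simp add: \<tau>_def field_simps)
    have "real n * c' / (\<tau> + 1) \<le> real n * c'"
      using \<tau> n c' by (simp add: divide_le_eq mult_le_cancel_left1 not_less)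
    also have "real n * c' < s"
      using c' n by (simp add: c_def pos_less_divide_eq mult.commute)
    finally show nonneg: "0 \<le> s - real n * c' / (1 / real n + c' + 1)" by (simp add: \<tau>_def)
    show "s - real n * c' / (1 / real n + c' + 1) < s"
      using \<tau> n c' by (simp add: \<tau>_def add_pos_pos)
    fix t assume t: "s - real n * c' / (1 / real n + c' + 1) < t" "t < s"
    then have "s - t < real n * c' / (\<tau> + 1)" by (simp add: \<tau>_def)
    then have exponent: "1 + (\<tau> + 1) * (s - t) < \<tau> * real n"
      using \<tau> by (simp add: \<tau>n pos_less_divide_eq mult.commute)
    obtain C1 C2 M where C: "C1 > 0" "C2 > 0"
      and count: "\<And>(Q::nat) \<delta>. real Q \<ge> M \<Longrightarrow> C1 * real Q powr (-\<alpha>) \<le> \<delta> \<Longrightarrow> \<delta> < 1 \<Longrightarrow>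
                  (\<Sum>q=Q..2*Q. measure \<mu> (approx_set \<delta> q \<gamma>)) \<le> C2 * real Q * \<delta> ^ n"
      using gcp[OF \<gamma>] by metis
    have "hausdorff_measure t (well_approx (\<lambda>q. real q powr (-\<tau>)) \<gamma> \<inter> measure_support \<mu>) = 0"
    proof (rule hausdorff_measure_well_approx_eq_0[OF assms(4,3) \<tau>(1) c0 lower C \<tau>(2) count])
      show "0 < t" "t \<le> s" using t nonneg by linarith+
    qed (use exponent in simp_all)
    moreover have "-\<tau> = - 1 / real n - c'" by (simp add: \<tau>_def)
    ultimately show "hausdorff_measure t
        (well_approx (\<lambda>q. real q powr (- 1 / real n - c')) \<gamma> \<inter> measure_support \<mu>) = 0"
      by simp
  qed
  moreover have "c > 0" using \<alpha> n assms by (simp add: c_def)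
  ultimately show ?thesis unfolding n_def by blast
qed

end
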